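(* Let $m,i\in\mathbb{N}^*$ and let $(G_t)_{t\ge1}$ be the pure anti-preferential attachment random graph process with parameter $m$. For $l\in\mathbb{N}^*$ put $c_l=\frac{2ml+1}{l(2ml+1-2m)}$. Then, for every fixed real $s>1$, $$\lim_{t\to\infty}\frac{d(v_i,t)}{\left(\sum_{l=i}^{t-1}\ln(1+c_l)\right)^s}=0\qquad\text{almost surely.}$$
   Context: $\mathbb{N}^*=\{1,2,\dots\}$. The pure anti-preferential attachment random graph process with parameter $m\in\mathbb{N}^*$ (the case $p=1$ of the paper's PA-APA model) is the following sequence $(G_t)_{t\ge1}$ of random undirected multigraphs, where $G_t$ has vertices $v_1,\dots,v_t$ and $mt$ edges. Let $d(v_i,t)$ denote the degree of $v_i$ in $G_t$ for $t\ge i$ (multiple edges are counted with multiplicity, and a self-loop contributes $2$), and $d(v_i,t)=0$ for $t<i$. Let $\mathcal{F}_t=\sigma(G_s: 1\le s\le t)$. $G_1$ consists of the single vertex $v_1$ with $m$ self-loops (so $d(v_1,1)=2m$). For each $t\ge1$, $G_{t+1}$ is obtained from $G_t$ by adding a new vertex $v_{t+1}$ and $m$ edges joining $v_{t+1}$ to vertices $W_{t+1}^1,\dots,W_{t+1}^m\in\{v_1,\dots,v_t\}$ (repetitions allowed, giving multiple edges), which, given $\mathcal{F}_t$, are chosen independently with $$\mathbb{P}(W_{t+1}^r=v_i\mid\mathcal{F}_t)=\frac{2mt+1-d(v_i,t)}{t(2mt+1-2m)},\qquad 1\le i\le t,\ 1\le r\le m.$$ *)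

theory Defs
  imports "HOL-Probability.Probability" "HOL-Library.Uprod"
begin

datatype 'v multigraph = Multigraph (verts: "'v set") (edges: "'v uprod multiset")

text \<open>The second summand counts self-loops once more.\<close>

definition degree :: "'v multigraph \<Rightarrow> 'v \<Rightarrow> nat" where
  "degree g v = size {#e \<in># edges g. v \<in> set_uprod e#} + size {#e \<in># edges g. e = Upair v v#}"

definition cond_probability :: "'a measure \<Rightarrow> 'a measure \<Rightarrow> 'a set \<Rightarrow> 'a \<Rightarrow> real" where
  "cond_probability M F A = real_cond_exp M F (indicator A)"

text \<open>The conditional counterpart of \<^const>\<open>prob_space.indep_vars\<close>.\<close>

definition cond_indep_vars ::
  "'a measure \<Rightarrow> 'a measure \<Rightarrow> ('i \<Rightarrow> 'b measure) \<Rightarrow> ('i \<Rightarrow> 'a \<Rightarrow> 'b) \<Rightarrow> 'i set \<Rightarrow> bool" where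
  "cond_indep_vars M F N X I \<longleftrightarrow>
     (\<forall>i\<in>I. X i \<in> measurable M (N i)) \<and>
     (\<forall>J\<subseteq>I. finite J \<longrightarrow> J \<noteq> {} \<longrightarrow> (\<forall>A. (\<forall>j\<in>J. A j \<in> sets (N j)) \<longrightarrow>
        (AE \<omega> in M. cond_probability M F (\<Inter>j\<in>J. X j -` A j \<inter> space M) \<omega>
                  = (\<Prod>j\<in>J. cond_probability M F (X j -` A j \<inter> space M) \<omega>))))"

text \<open>The \<open>\<sigma>\<close>-algebra generated by \<open>G\<^sub>1, \<dots>, G\<^sub>t\<close>, graphs carrying the discrete \<open>\<sigma>\<close>-algebra.\<close>

definition history :: "'a measure \<Rightarrow> (nat \<Rightarrow> 'a \<Rightarrow> 'g) \<Rightarrow> nat \<Rightarrow> 'a measure" where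
  "history M G t = sigma (space M) {G s -` B \<inter> space M | s B. 1 \<le> s \<and> s \<le> t}"

definition vertex_degree :: "(nat \<Rightarrow> 'a \<Rightarrow> nat multigraph) \<Rightarrow> nat \<Rightarrow> nat \<Rightarrow> 'a \<Rightarrow> nat" where
  "vertex_degree G i t \<omega> = (if i \<le> t then degree (G t \<omega>) i else 0)"

text \<open>The natural number \<open>i \<ge> 1\<close> stands for the vertex \<open>v\<^sub>i\<close>; \<open>W t r\<close> is the older end of
  the \<open>r\<close>-th edge added together with vertex \<open>t\<close>. The values of \<open>G\<close> at \<open>0\<close> and of
  \<open>W\<close> at \<open>0\<close> and \<open>1\<close> are irrelevant.\<close>

locale anti_preferential_attachment = prob_space M
  for M :: "'a measure"
    and m :: nat
    and G :: "nat \<Rightarrow> 'a \<Rightarrow> nat multigraph"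
    and W :: "nat \<Rightarrow> nat \<Rightarrow> 'a \<Rightarrow> nat" +
  assumes m_pos: "1 \<le> m"
    and G_measurable: "1 \<le> t \<Longrightarrow> G t \<in> measurable M (count_space UNIV)"
    and G_init: "\<omega> \<in> space M \<Longrightarrow> G 1 \<omega> = Multigraph {1} (replicate_mset m (Upair 1 1))"
    and W_range: "\<lbrakk>1 \<le> t; r \<in> {1..m}; \<omega> \<in> space M\<rbrakk> \<Longrightarrow> W (t + 1) r \<omega> \<in> {1..t}"
    and G_step: "\<lbrakk>1 \<le> t; \<omega> \<in> space M\<rbrakk> \<Longrightarrow>
      G (t + 1) \<omega> = Multigraph (insert (t + 1) (verts (G t \<omega>)))
        (edges (G t \<omega>) + {# Upair (t + 1) (W (t + 1) r \<omega>). r \<in># mset_set {1..m} #})"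
    and W_cond_indep: "1 \<le> t \<Longrightarrow>
      cond_indep_vars M (history M G t) (\<lambda>_. count_space UNIV) (W (t + 1)) {1..m}"
    and W_cond_distr: "\<lbrakk>1 \<le> t; r \<in> {1..m}; k \<in> {1..t}\<rbrakk> \<Longrightarrow>
      AE \<omega> in M. cond_probability M (history M G t) {\<omega> \<in> space M. W (t + 1) r \<omega> = k} \<omega>
        = (2 * real m * real t + 1 - real (vertex_degree G k t \<omega>))
          / (real t * (2 * real m * real t + 1 - 2 * real m))"

definition apa_coeff :: "nat \<Rightarrow> nat \<Rightarrow> real" where
  "apa_coeff m l =
     (2 * real m * real l + 1) / (real l * (2 * real m * real l + 1 - 2 * real m))"

end

theory Submission
  imports Defs "HOL-Real_Asymp.Multiseries_Expansion"
begin

text \<open>Write \<open>S\<^sub>t\<close> for the sum \<open>\<Sum>l = i..<t. ln (1 + c\<^sub>l)\<close> and \<open>X\<^sub>t\<close> for the number of edges that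
  vertex \<open>t + 1\<close> sends to vertex \<open>i\<close>. First moments suffice.

  Dropping the degree from the numerator of the attachment probability gives
  \<open>E X\<^sub>t \<le> m c\<^sub>t\<close> (\<open>prob_attach_le\<close>), and \<open>c\<^sub>t \<le> (2 m + 2) ln (1 + c\<^sub>t)\<close> because
  \<open>c\<^sub>t\<close> is bounded by \<open>2 m + 1\<close>. Thus \<open>E X\<^sub>t\<close> is at most a constant times \<open>S\<^bsub>t+1\<^esub> - S\<^sub>t\<close>, and
  comparison with the integral of \<open>x\<^bsup>-s\<^esup>\<close> shows that the series of \<open>E X\<^sub>t / S\<^bsub>t+1\<^esub>\<^sup>s\<close> converges
  (\<open>summable_increment_over_powr\<close>). Hence the series of \<open>X\<^sub>t / S\<^bsub>t+1\<^esub>\<^sup>s\<close> converges almost surely.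
  As \<open>S\<close> tends to infinity (\<open>c\<^sub>l \<ge> 1 / l\<close>), Kronecker's lemma for nonnegative terms
  (\<open>kronecker_nonneg\<close>) then says that the degree, which is the sum of the \<open>X\<^sub>t\<close> up to an initial
  value, is negligible against \<open>S\<^sub>t\<^sup>s\<close>.\<close>

section \<open>Series of nonnegative terms\<close>

text \<open>For nonnegative terms Kronecker's lemma is an instance of dominated convergence: the
  \<open>k\<close>-th summand \<open>x k / a n\<close> tends to \<open>0\<close> and is dominated by \<open>x k / a k\<close>.\<close>

lemma kronecker_nonneg:
  fixes a x :: "nat \<Rightarrow> real"
  assumes pos: "\<And>n. 0 < a n" and mono: "incseq a" and lim: "filterlim a at_top sequentially"
    and nonneg: "\<And>n. 0 \<le> x n" and summ: "summable (\<lambda>n. x n / a n)"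
  shows "(\<lambda>n. (\<Sum>k\<le>n. x k) / a n) \<longlonglongrightarrow> 0"
proof -
  define f where "f k n = (if k \<le> n then x k / a n else 0)" for k n
  have "(\<lambda>n. f k n) \<longlonglongrightarrow> 0" for k
  proof (rule Lim_transform_eventually)
    show "(\<lambda>n. x k / a n) \<longlonglongrightarrow> 0"
      by (rule real_tendsto_divide_at_top[OF tendsto_const lim])
    show "\<forall>\<^sub>F n in sequentially. x k / a n = f k n"
      using eventually_ge_at_top[of k] by eventually_elim (simp add: f_def)
  qed
  moreover have "norm (f k n) \<le> x k / a k" for k n
  proof (cases "k \<le> n")
    case True
    then have "a k \<le> a n"
      using mono by (simp add: incseq_def)
    then show ?thesis
      using True pos[of k] pos[of n] nonneg[of k] by (simp add: f_def frac_le)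
  next
    case False
    then show ?thesis
      using pos[of k] nonneg[of k] by (simp add: f_def)
  qed
  ultimately have "(\<lambda>n. \<Sum>k. f k n) \<longlonglongrightarrow> (\<Sum>k::nat. 0)"
    using tannerys_theorem[of f "\<lambda>_. 0" sequentially "\<lambda>k. x k / a k"] summ
    by (simp add: case_prod_unfold)
  moreover have "(\<Sum>k. f k n) = (\<Sum>k\<le>n. x k) / a n" for n
  proof -
    have "(\<Sum>k. f k n) = (\<Sum>k\<le>n. f k n)"
      by (rule suminf_finite) (auto simp: f_def)
    then show ?thesis
      by (simp add: f_def sum_divide_distrib)
  qed
  ultimately show ?thesis
    by simp
qed

text \<open>The left-hand quotient is a lower rectangle sum for the integral of \<open>x\<^bsup>-s\<^esup>\<close> over
  \<open>[a, b]\<close>, and the right-hand side is \<open>s - 1\<close> times this integral.\<close>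

lemma increment_over_powr_le:
  fixes a b s :: real
  assumes "0 < a" "a \<le> b" "1 < s"
  shows "(s - 1) * ((b - a) / b powr s) \<le> a powr (1 - s) - b powr (1 - s)"
proof (cases "a = b")
  case False
  with assms have "a < b"
    by simp
  obtain z where z: "a < z" "z < b"
    and eq: "b powr (1 - s) - a powr (1 - s) = (b - a) * ((1 - s) * z powr ((1 - s) - 1))"
  proof -
    have "((\<lambda>x. x powr (1 - s)) has_real_derivative (1 - s) * x powr ((1 - s) - 1)) (at x)"
      if "a \<le> x" for x
      using that assms by (intro has_real_derivative_powr) simp
    then show ?thesis
      using MVT2[OF \<open>a < b\<close>, of "\<lambda>x. x powr (1 - s)" "\<lambda>x. (1 - s) * x powr ((1 - s) - 1)"] that
      by blast
  qed
  have "b powr (- s) \<le> z powr (- s)"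
    using z assms by (intro powr_mono2') auto
  then have "((s - 1) * (b - a)) * b powr (- s) \<le> ((s - 1) * (b - a)) * z powr (- s)"
    using assms by (intro mult_left_mono) auto
  also have "\<dots> = a powr (1 - s) - b powr (1 - s)"
    using eq by (simp add: algebra_simps)
  finally show ?thesis
    by (simp add: powr_minus_divide)
qed (use assms in simp)

lemma summable_increment_over_powr:
  fixes b :: "nat \<Rightarrow> real" and s :: real
  assumes pos: "\<And>n. 0 < b n" and mono: "incseq b" and s: "1 < s"
  shows "summable (\<lambda>n. (b (Suc n) - b n) / b (Suc n) powr s)"
proof (rule summableI_nonneg_bounded)
  have le: "b n \<le> b (Suc n)" for n
    using mono by (simp add: incseq_SucD)
  show "0 \<le> (b (Suc n) - b n) / b (Suc n) powr s" for n
    using le[of n] by simp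
  fix n
  have "(s - 1) * (\<Sum>k<n. (b (Suc k) - b k) / b (Suc k) powr s)
      \<le> (\<Sum>k<n. b k powr (1 - s) - b (Suc k) powr (1 - s))"
    unfolding sum_distrib_left
    by (intro sum_mono increment_over_powr_le pos le s)
  also have "\<dots> = b 0 powr (1 - s) - b n powr (1 - s)"
    by (rule sum_lessThan_telescope')
  also have "\<dots> \<le> b 0 powr (1 - s)"
    by simp
  finally show "(\<Sum>k<n. (b (Suc k) - b k) / b (Suc k) powr s) \<le> b 0 powr (1 - s) / (s - 1)"
    using s by (simp add: field_simps)
qed

lemma AE_summable_of_summable_integral:
  fixes Y :: "nat \<Rightarrow> 'a \<Rightarrow> real"
  assumes int: "\<And>n. integrable M (Y n)" and nonneg: "\<And>n \<omega>. 0 \<le> Y n \<omega>"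
    and summ: "summable (\<lambda>n. \<integral>\<omega>. Y n \<omega> \<partial>M)"
  shows "AE \<omega> in M. summable (\<lambda>n. Y n \<omega>)"
proof -
  have [measurable]: "Y n \<in> borel_measurable M" for n
    using int by auto
  have "(\<integral>\<^sup>+\<omega>. (\<Sum>n. ennreal (Y n \<omega>)) \<partial>M) = (\<Sum>n. \<integral>\<^sup>+\<omega>. ennreal (Y n \<omega>) \<partial>M)"
    by (rule nn_integral_suminf) measurable
  also have "\<dots> = (\<Sum>n. ennreal (\<integral>\<omega>. Y n \<omega> \<partial>M))"
    by (simp add: nn_integral_eq_integral int nonneg)
  also have "\<dots> = ennreal (\<Sum>n. \<integral>\<omega>. Y n \<omega> \<partial>M)"
    by (rule suminf_ennreal2) (simp_all add: nonneg summ)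
  finally have "(\<integral>\<^sup>+\<omega>. (\<Sum>n. ennreal (Y n \<omega>)) \<partial>M) \<noteq> \<infinity>"
    by simp
  then have "AE \<omega> in M. (\<Sum>n. ennreal (Y n \<omega>)) \<noteq> \<infinity>"
    by (intro nn_integral_PInf_AE) measurable
  then show ?thesis
    by eventually_elim (auto intro!: summable_suminf_not_top simp: nonneg)
qed

section \<open>The coefficients\<close>

lemma apa_denominator_ge:
  assumes "1 \<le> l"
  shows "real l \<le> real l * (2 * real m * real l + 1 - 2 * real m)"
proof -
  have "0 \<le> 2 * real m * (real l - 1)"
    using assms by simp
  then have "1 \<le> 2 * real m * real l + 1 - 2 * real m"
    by (simp add: algebra_simps)
  then show ?thesis
    using mult_left_mono[of 1 _ "real l"] by simp
qed

lemma apa_coeff_ge: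
  assumes "1 \<le> l"
  shows "1 / real l \<le> apa_coeff m l"
proof -
  define d where "d = 2 * real m * real l + 1 - 2 * real m"
  have d: "0 < real l * d" "d \<le> 2 * real m * real l + 1"
    using apa_denominator_ge[OF assms, of m] assms by (auto simp: d_def)
  then have "1 / real l = d / (real l * d)"
    by auto
  also have "\<dots> \<le> (2 * real m * real l + 1) / (real l * d)"
    using d by (intro divide_right_mono) auto
  finally show ?thesis
    by (simp add: apa_coeff_def d_def)
qed

lemma apa_coeff_le:
  assumes "1 \<le> l"
  shows "apa_coeff m l \<le> 2 * real m + 1"
proof -
  have "2 * real m * real l + 1 \<le> (2 * real m + 1) * real l"
    using assms by (simp add: algebra_simps)
  also have "\<dots> \<le> (2 * real m + 1) * (real l * (2 * real m * real l + 1 - 2 * real m))"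
    by (intro mult_left_mono apa_denominator_ge assms) simp
  finally show ?thesis
    using apa_denominator_ge[OF assms, of m] assms
    unfolding apa_coeff_def by (subst pos_divide_le_eq) (auto simp: mult.commute)
qed

lemma apa_coeff_pos: "1 \<le> l \<Longrightarrow> 0 < apa_coeff m l"
  using apa_coeff_ge[of l m] by (smt (verit) divide_pos_pos of_nat_0_less_iff less_le_trans zero_less_one)

lemma apa_coeff_le_ln:
  assumes "1 \<le> l"
  shows "apa_coeff m l \<le> (2 * real m + 2) * ln (1 + apa_coeff m l)"
proof -
  define c where "c = apa_coeff m l"
  have c: "0 < c" "c \<le> 2 * real m + 1"
    using apa_coeff_pos apa_coeff_le assms by (auto simp: c_def)
  \<comment> \<open>This is \<open>ln x \<le> x - 1\<close> at \<open>x = 1 / (1 + c)\<close>.\<close>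
  have "1 - 1 / (1 + c) \<le> ln (1 + c)"
    using ln_le_minus_one[of "1 / (1 + c)"] c by (simp add: ln_div)
  then have "c \<le> (1 + c) * ln (1 + c)"
    using c by (simp add: field_simps)
  also have "\<dots> \<le> (2 * real m + 2) * ln (1 + c)"
    using c by (intro mult_right_mono) auto
  finally show ?thesis
    by (simp add: c_def)
qed

lemma sum_ln_apa_coeff_at_top:
  assumes "1 \<le> i"
  shows "filterlim (\<lambda>t. \<Sum>l = i..<t. ln (1 + apa_coeff m l)) at_top sequentially"
proof -
  define h where "h n = ln (1 + apa_coeff m (n + i))" for n
  have h_ge: "inverse (real (n + i)) \<le> (2 * real m + 2) * h n" for n
    using apa_coeff_ge[of "n + i" m] apa_coeff_le_ln[of "n + i" m] assms
    by (simp add: h_def divide_inverse)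
  have h_nonneg: "0 \<le> h n" for n
    using apa_coeff_pos[of "n + i" m] assms by (simp add: h_def)
  have "\<not> summable h"
  proof
    assume "summable h"
    then have "summable (\<lambda>n. (2 * real m + 2) * h n)"
      by (rule summable_mult)
    then have "summable (\<lambda>n. inverse (real (n + i)))"
      by (rule summable_comparison_test') (use h_ge in simp)
    then show False
      using not_summable_harmonic[where 'a = real]
        summable_iff_shift[of "\<lambda>n. inverse (real n)" i] by simp
  qed
  have shift: "(\<Sum>l = i..<n + i. ln (1 + apa_coeff m l)) = (\<Sum>k<n. h k)" for n
    using sum.shift_bounds_nat_ivl[of "\<lambda>l. ln (1 + apa_coeff m l)" 0 i n]
    by (simp add: h_def atLeast0LessThan)
  show ?thesis
    unfolding filterlim_at_top
  proof
    fix Z :: real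
    obtain n where n: "Z < (\<Sum>k<n. h k)"
      using \<open>\<not> summable h\<close> summableI_nonneg_bounded[of h Z] h_nonneg by (meson not_le)
    have "Z \<le> (\<Sum>l = i..<t. ln (1 + apa_coeff m l))" if "n + i \<le> t" for t
    proof -
      have "(\<Sum>l = i..<n + i. ln (1 + apa_coeff m l)) \<le> (\<Sum>l = i..<t. ln (1 + apa_coeff m l))"
      proof (rule sum_mono2)
        show "0 \<le> ln (1 + apa_coeff m l)" if "l \<in> {i..<t} - {i..<n + i}" for l
          using that assms apa_coeff_pos[of l m] by simp
      qed (use that in auto)
      with n shift[of n] show ?thesis
        by simp
    qed
    then show "\<forall>\<^sub>F t in sequentially. Z \<le> (\<Sum>l = i..<t. ln (1 + apa_coeff m l))"
      unfolding eventually_sequentially by blast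
  qed
qed

section \<open>The degree of a fixed vertex\<close>

lemma subalgebra_history:
  assumes "\<And>s. 1 \<le> s \<Longrightarrow> s \<le> t \<Longrightarrow> G s \<in> measurable M (count_space UNIV)"
  shows "subalgebra M (history M G t)"
proof -
  have "{G s -` B \<inter> space M |s B. 1 \<le> s \<and> s \<le> t} \<subseteq> sets M"
    using assms by (auto intro: measurable_sets)
  then show ?thesis
    unfolding subalgebra_def history_def
    by (auto simp: space_measure_of_conv intro!: sets.sigma_sets_subset dest: sets.sets_into_space
        simp: sets_measure_of[OF order_trans[OF _ sets.space_closed]])
qed

context anti_preferential_attachment
begin

lemma W_measurable:
  assumes "1 \<le> t" "r \<in> {1..m}"
  shows "W (t + 1) r \<in> measurable M (count_space UNIV)"
  using W_cond_indep[OF assms(1)] assms(2) by (simp add: cond_indep_vars_def)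

text \<open>The conditional attachment probability is at most \<open>apa_coeff m t\<close> because degrees are
  nonnegative; taking expectations removes the conditioning.\<close>

lemma prob_attach_le:
  assumes t: "1 \<le> t" and r: "r \<in> {1..m}" and k: "k \<in> {1..t}"
  shows "prob {\<omega> \<in> space M. W (t + 1) r \<omega> = k} \<le> apa_coeff m t"
proof -
  define A where "A = {\<omega> \<in> space M. W (t + 1) r \<omega> = k}"
  have A: "A \<in> sets M"
    unfolding A_def using W_measurable[OF t r] by measurable
  have "finite_measure_subalgebra M (history M G t)"
    by unfold_locales (intro subalgebra_history G_measurable)
  then interpret sub: finite_measure_subalgebra M "history M G t" .
  have int: "integrable M (indicator A :: 'a \<Rightarrow> real)"
    using A by (simp add: emeasure_eq_measure)
  have "prob A = (\<integral>\<omega>. indicator A \<omega> \<partial>M)"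
    using A by simp
  also have "\<dots> = (\<integral>\<omega>. cond_probability M (history M G t) A \<omega> \<partial>M)"
    unfolding cond_probability_def by (rule sub.real_cond_exp_int(2)[OF int, symmetric])
  also have "\<dots> \<le> (\<integral>\<omega>. apa_coeff m t \<partial>M)"
  proof (rule integral_mono_AE)
    show "integrable M (cond_probability M (history M G t) A)"
      unfolding cond_probability_def by (rule sub.real_cond_exp_int(1)[OF int])
    show "AE \<omega> in M. cond_probability M (history M G t) A \<omega> \<le> apa_coeff m t"
      using W_cond_distr[OF t r k]
    proof eventually_elim
      case (elim \<omega>)
      have "0 \<le> real t * (2 * real m * real t + 1 - 2 * real m)"
        using apa_denominator_ge[OF t, of m] by linarith
      then show ?case
        unfolding A_def elim apa_coeff_def by (intro divide_right_mono) auto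
    qed
  qed simp
  also have "\<dots> = apa_coeff m t"
    by (simp add: prob_space)
  finally show ?thesis
    by (simp add: A_def)
qed

text \<open>The number of edges that vertex \<open>t + 1\<close> sends to vertex \<open>i\<close>, as a real-valued sum of
  indicators, so that its expectation is a sum of probabilities.\<close>

definition new_edges :: "nat \<Rightarrow> nat \<Rightarrow> 'a \<Rightarrow> real" where
  "new_edges i t \<omega> = (\<Sum>r = 1..m. indicator {\<omega> \<in> space M. W (t + 1) r \<omega> = i} \<omega>)"

lemma vertex_degree_step:
  assumes "1 \<le> i" "i \<le> t" and \<omega>: "\<omega> \<in> space M"
  shows "real (vertex_degree G i (t + 1) \<omega>) = real (vertex_degree G i t \<omega>) + new_edges i t \<omega>"
proof -
  let ?N = "{# Upair (t + 1) (W (t + 1) r \<omega>). r \<in># mset_set {1..m} #}"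
  have E: "edges (G (t + 1) \<omega>) = edges (G t \<omega>) + ?N"
    using G_step[of t \<omega>] assms by simp
  have "(i \<in> set_uprod (Upair (t + 1) w)) = (w = i)" for w
    using assms by auto
  then have "filter_mset (\<lambda>e. i \<in> set_uprod e) ?N
      = {# Upair (t + 1) (W (t + 1) r \<omega>). r \<in># mset_set {r \<in> {1..m}. W (t + 1) r \<omega> = i} #}"
    by (simp only: filter_mset_image_mset filter_mset_mset_set finite_atLeastAtMost)
  then have new: "size (filter_mset (\<lambda>e. i \<in> set_uprod e) ?N) = card {r \<in> {1..m}. W (t + 1) r \<omega> = i}"
    by simp
  \<comment> \<open>The new edges end in \<open>t + 1 \<noteq> i\<close>, so none of them is a loop at \<open>i\<close>.\<close>
  have loops: "filter_mset (\<lambda>e. e = Upair i i) ?N = {#}"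
    using assms by (auto simp: filter_mset_image_mset)
  have "new_edges i t \<omega> = (\<Sum>r \<in> {1..m}. if W (t + 1) r \<omega> = i then 1 else 0)"
    unfolding new_edges_def using \<omega> by (intro sum.cong) auto
  also have "\<dots> = real (card {r \<in> {1..m}. W (t + 1) r \<omega> = i})"
    by (simp flip: sum.inter_filter)
  finally show ?thesis
    using assms E new loops by (simp add: vertex_degree_def degree_def)
qed

lemma vertex_degree_eq_sum_new_edges:
  assumes "1 \<le> i" and \<omega>: "\<omega> \<in> space M"
  shows "real (vertex_degree G i (n + i) \<omega>)
    = real (vertex_degree G i i \<omega>) + (\<Sum>k<n. new_edges i (k + i) \<omega>)"
  by (induction n) (use vertex_degree_step[OF assms(1) _ \<omega>] in auto)

lemma expectation_new_edges:
  assumes "1 \<le> i" "i \<le> t"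
  shows "integrable M (new_edges i t)"
    and "expectation (new_edges i t) \<le> real m * apa_coeff m t"
proof -
  have sets: "{\<omega> \<in> space M. W (t + 1) r \<omega> = i} \<in> sets M" if "r \<in> {1..m}" for r
  proof -
    have [measurable]: "W (t + 1) r \<in> measurable M (count_space UNIV)"
      using W_measurable that assms by simp
    show ?thesis
      by measurable
  qed
  show "integrable M (new_edges i t)"
    unfolding new_edges_def using sets
    by (intro Bochner_Integration.integrable_sum integrable_real_indicator)
      (simp_all add: emeasure_eq_measure)
  have "expectation (new_edges i t) = (\<Sum>r = 1..m. prob {\<omega> \<in> space M. W (t + 1) r \<omega> = i})"
    unfolding new_edges_def using sets
    by (subst Bochner_Integration.integral_sum) (auto simp: emeasure_eq_measure)
  also have "\<dots> \<le> (\<Sum>r = 1..m. apa_coeff m t)"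
    using assms by (intro sum_mono prob_attach_le) auto
  finally show "expectation (new_edges i t) \<le> real m * apa_coeff m t"
    by simp
qed

theorem AE_degree_negligible:
  assumes i: "1 \<le> i" and s: "1 < s"
  shows "AE \<omega> in M. (\<lambda>t. real (vertex_degree G i t \<omega>)
    / (\<Sum>l = i..<t. ln (1 + apa_coeff m l)) powr s) \<longlonglongrightarrow> 0"
proof -
  define S where "S t = (\<Sum>l = i..<t. ln (1 + apa_coeff m l))" for t
  \<comment> \<open>The index starts at \<open>Suc i\<close> because \<open>S i = 0\<close>.\<close>
  define b where "b n = S (Suc n + i)" for n
  define C where "C = real m * (2 * real m + 2)"
  have ln_pos: "0 < ln (1 + apa_coeff m l)" if "1 \<le> l" for l
    using apa_coeff_pos[OF that, of m] by simp
  have b_Suc: "b (Suc n) = b n + ln (1 + apa_coeff m (Suc n + i))" for n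
    by (simp add: b_def S_def)
  have mono: "incseq b"
    using b_Suc ln_pos by (intro incseq_SucI) (simp add: less_imp_le)
  have pos: "0 < b n" for n
    unfolding b_def S_def using i by (intro sum_pos ln_pos) auto
  have S_top: "filterlim S at_top sequentially"
    unfolding S_def by (rule sum_ln_apa_coeff_at_top[OF i])
  then have b_top: "filterlim b at_top sequentially"
    unfolding b_def by (rule filterlim_compose) (rule filterlim_subseq, simp add: strict_mono_def)
  have powr_top: "filterlim (\<lambda>n. b n powr s) at_top sequentially"
    using s by (intro filterlim_compose[OF real_powr_at_top b_top]) simp

  define Y where "Y n = (\<lambda>\<omega>. new_edges i (n + i) \<omega> / b n powr s)" for n
  have Y_int: "integrable M (Y n)" for n
    unfolding Y_def using expectation_new_edges(1)[of i "n + i"] i by simp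
  have Y_nonneg: "0 \<le> Y n \<omega>" for n \<omega>
    by (simp add: Y_def new_edges_def sum_nonneg)
  have "summable (\<lambda>n. C * ((b (Suc n) - b n) / b (Suc n) powr s))"
    by (intro summable_mult summable_increment_over_powr pos mono s)
  moreover have "norm (expectation (Y (Suc n))) \<le> C * ((b (Suc n) - b n) / b (Suc n) powr s)" for n
  proof -
    have "expectation (new_edges i (Suc n + i)) \<le> real m * apa_coeff m (Suc n + i)"
      using expectation_new_edges(2)[of i "Suc n + i"] i by simp
    also have "\<dots> \<le> real m * ((2 * real m + 2) * ln (1 + apa_coeff m (Suc n + i)))"
      by (intro mult_left_mono apa_coeff_le_ln) auto
    also have "\<dots> = C * (b (Suc n) - b n)"
      by (simp add: C_def b_Suc)
    finally have "expectation (new_edges i (Suc n + i)) / b (Suc n) powr s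
        \<le> C * (b (Suc n) - b n) / b (Suc n) powr s"
      by (intro divide_right_mono) simp_all
    then have "expectation (Y (Suc n)) \<le> C * ((b (Suc n) - b n) / b (Suc n) powr s)"
      by (simp add: Y_def)
    then show ?thesis
      using Y_nonneg by (simp add: integral_nonneg_AE)
  qed
  ultimately have "summable (\<lambda>n. expectation (Y (Suc n)))"
    by (rule summable_comparison_test'[where N = 0])
  then have "summable (\<lambda>n. expectation (Y n))"
    using summable_Suc_iff[of "\<lambda>n. expectation (Y n)"] by blast
  then have "AE \<omega> in M. summable (\<lambda>n. Y n \<omega>)"
    by (intro AE_summable_of_summable_integral Y_int Y_nonneg)
  then have "AE \<omega> in M. (\<lambda>t. real (vertex_degree G i t \<omega>) / S t powr s) \<longlonglongrightarrow> 0"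
    using AE_space
  proof eventually_elim
    case (elim \<omega>)
    have "(\<lambda>n. (\<Sum>k\<le>n. new_edges i (k + i) \<omega>) / b n powr s) \<longlonglongrightarrow> 0"
    proof (rule kronecker_nonneg)
      show "0 < b n powr s" for n
        using pos[of n] by simp
      show "incseq (\<lambda>n. b n powr s)"
        using mono pos s by (simp add: incseq_def powr_mono2 less_imp_le)
      show "0 \<le> new_edges i (n + i) \<omega>" for n
        by (simp add: new_edges_def sum_nonneg)
      show "summable (\<lambda>n. new_edges i (n + i) \<omega> / b n powr s)"
        using elim(1) by (simp add: Y_def)
    qed (rule powr_top)
    moreover have "(\<lambda>n. real (vertex_degree G i i \<omega>) / b n powr s) \<longlonglongrightarrow> 0"
      by (rule real_tendsto_divide_at_top[OF tendsto_const powr_top])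
    ultimately have "(\<lambda>n. real (vertex_degree G i i \<omega>) / b n powr s
        + (\<Sum>k\<le>n. new_edges i (k + i) \<omega>) / b n powr s) \<longlonglongrightarrow> 0 + 0"
      by (intro tendsto_add)
    then have "(\<lambda>n. real (vertex_degree G i (n + Suc i) \<omega>) / S (n + Suc i) powr s) \<longlonglongrightarrow> 0"
      using vertex_degree_eq_sum_new_edges[OF i elim(2), of "Suc _"]
      by (simp add: b_def add_divide_distrib lessThan_Suc_atMost)
    then show ?case
      by (rule LIMSEQ_offset)
  qed
  then show ?thesis
    by (simp add: S_def)
qed

end

theorem theorem3p5:
  fixes M :: "'a measure" and m i :: nat and s :: real
    and G :: "nat \<Rightarrow> 'a \<Rightarrow> nat multigraph" and W :: "nat \<Rightarrow> nat \<Rightarrow> 'a \<Rightarrow> nat"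
  assumes "anti_preferential_attachment M m G W"
    and "1 \<le> i"
    and "1 < s"
  shows "AE \<omega> in M.
    (\<lambda>t. real (vertex_degree G i t \<omega>) / (\<Sum>l = i..<t. ln (1 + apa_coeff m l)) powr s)
      \<longlonglongrightarrow> 0"
  using anti_preferential_attachment.AE_degree_negligible[OF assms] .

end
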